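(* Let $\mathbf C$ be a cubical $\omega$-category. Then: (a) $\mathbf C$ is a cubical $\omega$-groupoid (i.e. a cubical $(\omega,0)$-category) if and only if every $n$-cell of $\mathbf C$ is $R_i$-invertible for all $1\le i\le n$ (for every $n\ge1$). (b) $\mathbf C$ is a cubical $(\omega,1)$-category if and only if every $n$-cell of $\mathbf C$ is $T_i$-invertible for all $1\le i<n$ (for every $n\ge2$).
   Context: Index notation: for positive integers $i,j$, $j^i=j$ if $j<i$ and $j^i=j+1$ if $j\ge i$; for $j\neq i$, $j_i=j$ if $j<i$ and $j_i=j-1$ if $j>i$. Cubical $\omega$-categories (always with connections): a cubical $\omega$-category $\mathbf C$ consists of sets $\mathbf C_n$ ($n\ge0$), maps $\partial_i^\alpha:\mathbf C_n\to\mathbf C_{n-1}$ and $\Gamma_i^\alpha:\mathbf C_n\to\mathbf C_{n+1}$ ($n\ge1$, $1\le i\le n$, $\alpha=\pm$), maps $\epsilon_i:\mathbf C_n\to\mathbf C_{n+1}$ ($n\ge0$, $1\le i\le n+1$), and partial operations $\star_i$ on $\mathbf C_n$ ($n\ge1$, $1\le i\le n$), with $A\star_iB$ defined exactly when $\partial_i^+A=\partial_i^-B$, subject to (for all indices and cells for which both sides make sense): - $\partial_{j-1}^\alpha\partial_i^\beta=\partial_i^\beta\partial_j^\alpha$ for $i<j$; - $\partial_i^\alpha\epsilon_j=\epsilon_{j_i}\partial_{i_j}^\alpha$ for $i\ne j$, and $\partial_i^\alpha\epsilon_i=\mathrm{id}$; - $\partial_i^\alpha\Gamma_j^\beta=\Gamma_{j_i}^\beta\partial_{i_j}^\alpha$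 for $i\ne j,j+1$; for $i\in\{j,j+1\}$, $\partial_i^\alpha\Gamma_j^\alpha=\mathrm{id}$ and $\partial_i^\alpha\Gamma_j^{-\alpha}=\epsilon_j\partial_j^\alpha$; - $\epsilon_i\epsilon_j=\epsilon_{j+1}\epsilon_i$ for $i\le j$; $\Gamma_i^\alpha\Gamma_j^\beta=\Gamma_{j+1}^\beta\Gamma_i^\alpha$ for $i<j$; $\Gamma_{i+1}^\alpha\Gamma_i^\alpha=\Gamma_i^\alpha\Gamma_i^\alpha$; $\Gamma_i^\alpha\epsilon_j=\epsilon_{j^i}\Gamma_{i_j}^\alpha$ for $i\ne j$; $\Gamma_i^\alpha\epsilon_i=\epsilon_i\epsilon_i$; - $\partial_i^\alpha(A\star_jB)=\partial_i^\alpha A\star_{j_i}\partial_i^\alpha B$ for $i\neq j$; $\partial_i^-(A\star_iB)=\partial_i^-A$; $\partial_i^+(A\star_iB)=\partial_i^+B$; - $\star_i$ is associative; $A\star_i\epsilon_i\partial_i^+A=\epsilon_i\partial_i^-A\star_iA=A$; $(A\star_iB)\star_j(C\star_iD)=(A\star_jC)\star_i(B\star_jD)$ for $i\neq j$; - $\epsilon_i(A\star_jB)=\epsilon_iA\star_{j^i}\epsilon_iB$; $\Gamma_i^\alpha(A\star_jB)=\Gamma_i^\alpha A\star_{j^i}\Gamma_i^\alpha B$ for $i\ne j$; $\Gamma_i^-(A\star_iB)=(\Gamma_i^-A\star_i\epsilon_{i+1}B)\star_{i+1}(\epsilon_iB\star_i\Gamma_i^-B)$; $\Gamma_i^+(A\star_iB)=(\Gamma_i^+A\star_i\epsilon_iA)\star_{i+1}(\epsilon_{i+1}A\star_i\Gamma_i^+B)$;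 - $\Gamma_i^+A\star_i\Gamma_i^-A=\epsilon_{i+1}A$; $\Gamma_i^+A\star_{i+1}\Gamma_i^-A=\epsilon_iA$. $R_k$-invertibility. $A\in\mathbf C_n$ is $R_k$-invertible ($1\le k\le n$) if there is $B\in\mathbf C_n$ with $A\star_kB=\epsilon_k\partial_k^-A$ and $B\star_kA=\epsilon_k\partial_k^+A$. Plain invertibility. For $1\le i\le n-1$ and $A\in\mathbf C_n$ put $\psi_iA=\Gamma_i^+\partial_{i+1}^-A\star_{i+1}A\star_{i+1}\Gamma_i^-\partial_{i+1}^+A$. A cell $A\in\mathbf C_n$ ($n\ge1$) is invertible if $\psi_1\cdots\psi_{n-1}A$ is $R_1$-invertible. For a natural number $p$, a cubical $(\omega,p)$-category is a cubical $\omega$-category in which every $n$-cell with $n>p$ is invertible; a cubical $\omega$-groupoid is a cubical $(\omega,0)$-category. $T_i$-invertibility. For $1\le i<n$, $A\in\mathbf C_n$ is $T_i$-invertible if there is $B\in\mathbf C_n$ (its $T_i$-inverse) such that $\partial_i^\alpha A=\partial_{i+1}^\alpha B$ and $\partial_{i+1}^\alpha A=\partial_i^\alpha B$ for $\alpha=\pm$, and both of the following equations hold: $$(\Gamma_i^+\partial_{i+1}^-A\star_iB)\star_{i+1}(A\star_i\Gamma_i^-\partial_i^+A)=\Gamma_i^-\partial_i^-A\star_i\Gamma_i^+\partial_{i+1}^+A,$$ $$(\Gamma_i^+\partial_{i+1}^-B\star_iA)\star_{i+1}(B\star_i\Gamma_i^-\partial_i^+B)=\Gamma_i^-\partial_i^-B\star_i\Gamma_i^+\partial_{i+1}^+B.$$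 *)

theory Defs
  imports Main
begin

datatype sign = Neg | Pos

fun opp :: "sign \<Rightarrow> sign" where
  "opp Neg = Pos"
| "opp Pos = Neg"

text \<open>The reindexings \<open>j\<^sup>i\<close> (\<open>up j i\<close>) and \<open>j\<^sub>i\<close> (\<open>down j i\<close>); the latter is only used for \<open>j \<noteq> i\<close>.\<close>

definition up :: "nat \<Rightarrow> nat \<Rightarrow> nat" where
  "up j i = (if j < i then j else j + 1)"

definition down :: "nat \<Rightarrow> nat \<Rightarrow> nat" where
  "down j i = (if j < i then j else j - 1)"

text \<open>
  All operations take as first argument the dimension \<open>n\<close> of the cells they are applied to, so that
  the sets \<open>cells C n\<close> need not be disjoint. For \<open>A\<close>, \<open>B\<close> in \<open>cells C n\<close>:
  \<open>face C n i \<alpha> A\<close> is \<open>\<partial>\<^sub>i\<^sup>\<alpha> A\<close> (dimension \<open>n - 1\<close>),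
  \<open>degen C n i A\<close> is \<open>\<epsilon>\<^sub>i A\<close> (dimension \<open>n + 1\<close>),
  \<open>conn C n i \<alpha> A\<close> is \<open>\<Gamma>\<^sub>i\<^sup>\<alpha> A\<close> (dimension \<open>n + 1\<close>),
  and \<open>cmp C n i A B\<close> is the composite of \<open>A\<close> and \<open>B\<close> in direction \<open>i\<close> (dimension \<open>n\<close>).
  The functions are total; their values outside the index ranges below, or on pairs that are not
  composable, are unconstrained and carry no meaning.
\<close>

record 'a cubical =
  cells :: "nat \<Rightarrow> 'a set"
  face :: "nat \<Rightarrow> nat \<Rightarrow> sign \<Rightarrow> 'a \<Rightarrow> 'a"
  degen :: "nat \<Rightarrow> nat \<Rightarrow> 'a \<Rightarrow> 'a"
  conn :: "nat \<Rightarrow> nat \<Rightarrow> sign \<Rightarrow> 'a \<Rightarrow> 'a"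
  cmp :: "nat \<Rightarrow> nat \<Rightarrow> 'a \<Rightarrow> 'a \<Rightarrow> 'a"

definition composable :: "'a cubical \<Rightarrow> nat \<Rightarrow> nat \<Rightarrow> 'a \<Rightarrow> 'a \<Rightarrow> bool" where
  "composable C n i A B \<longleftrightarrow>
     A \<in> cells C n \<and> B \<in> cells C n \<and> i \<in> {1..n} \<and> face C n i Pos A = face C n i Neg B"

locale cubical_omega_category =
  fixes C :: "'a cubical"
  assumes face_closed:
      "\<lbrakk>A \<in> cells C n; i \<in> {1..n}\<rbrakk> \<Longrightarrow> face C n i \<alpha> A \<in> cells C (n - 1)"
    and degen_closed:
      "\<lbrakk>A \<in> cells C n; i \<in> {1..n + 1}\<rbrakk> \<Longrightarrow> degen C n i A \<in> cells C (n + 1)"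
    and conn_closed:
      "\<lbrakk>A \<in> cells C n; i \<in> {1..n}\<rbrakk> \<Longrightarrow> conn C n i \<alpha> A \<in> cells C (n + 1)"
    and cmp_closed:
      "composable C n i A B \<Longrightarrow> cmp C n i A B \<in> cells C n"
    and face_face:
      "\<lbrakk>A \<in> cells C n; 1 \<le> i; i < j; j \<le> n\<rbrakk> \<Longrightarrow>
         face C (n - 1) (j - 1) \<alpha> (face C n i \<beta> A) = face C (n - 1) i \<beta> (face C n j \<alpha> A)"
    and face_degen:
      "\<lbrakk>A \<in> cells C n; i \<in> {1..n + 1}; j \<in> {1..n + 1}; i \<noteq> j\<rbrakk> \<Longrightarrow>
         face C (n + 1) i \<alpha> (degen C n j A) = degen C (n - 1) (down j i) (face C n (down i j) \<alpha> A)"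
    and face_degen_same:
      "\<lbrakk>A \<in> cells C n; i \<in> {1..n + 1}\<rbrakk> \<Longrightarrow> face C (n + 1) i \<alpha> (degen C n i A) = A"
    and face_conn:
      "\<lbrakk>A \<in> cells C n; i \<in> {1..n + 1}; j \<in> {1..n}; i \<noteq> j; i \<noteq> j + 1\<rbrakk> \<Longrightarrow>
         face C (n + 1) i \<alpha> (conn C n j \<beta> A) = conn C (n - 1) (down j i) \<beta> (face C n (down i j) \<alpha> A)"
    and face_conn_same:
      "\<lbrakk>A \<in> cells C n; j \<in> {1..n}; i \<in> {j, j + 1}\<rbrakk> \<Longrightarrow> face C (n + 1) i \<alpha> (conn C n j \<alpha> A) = A"
    and face_conn_opp:
      "\<lbrakk>A \<in> cells C n; j \<in> {1..n}; i \<in> {j, j + 1}\<rbrakk> \<Longrightarrow>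
         face C (n + 1) i \<alpha> (conn C n j (opp \<alpha>) A) = degen C (n - 1) j (face C n j \<alpha> A)"
    and degen_degen:
      "\<lbrakk>A \<in> cells C n; 1 \<le> i; i \<le> j; j \<le> n + 1\<rbrakk> \<Longrightarrow>
         degen C (n + 1) i (degen C n j A) = degen C (n + 1) (j + 1) (degen C n i A)"
    and conn_conn:
      "\<lbrakk>A \<in> cells C n; 1 \<le> i; i < j; j \<le> n\<rbrakk> \<Longrightarrow>
         conn C (n + 1) i \<alpha> (conn C n j \<beta> A) = conn C (n + 1) (j + 1) \<beta> (conn C n i \<alpha> A)"
    and conn_conn_same:
      "\<lbrakk>A \<in> cells C n; i \<in> {1..n}\<rbrakk> \<Longrightarrow>
         conn C (n + 1) (i + 1) \<alpha> (conn C n i \<alpha> A) = conn C (n + 1) i \<alpha> (conn C n i \<alpha> A)"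
    and conn_degen:
      "\<lbrakk>A \<in> cells C n; i \<in> {1..n + 1}; j \<in> {1..n + 1}; i \<noteq> j\<rbrakk> \<Longrightarrow>
         conn C (n + 1) i \<alpha> (degen C n j A) = degen C (n + 1) (up j i) (conn C n (down i j) \<alpha> A)"
    and conn_degen_same:
      "\<lbrakk>A \<in> cells C n; i \<in> {1..n + 1}\<rbrakk> \<Longrightarrow>
         conn C (n + 1) i \<alpha> (degen C n i A) = degen C (n + 1) i (degen C n i A)"
    and face_cmp:
      "\<lbrakk>composable C n j A B; i \<in> {1..n}; i \<noteq> j\<rbrakk> \<Longrightarrow>
         face C n i \<alpha> (cmp C n j A B) = cmp C (n - 1) (down j i) (face C n i \<alpha> A) (face C n i \<alpha> B)"
    and face_Neg_cmp:
      "composable C n i A B \<Longrightarrow> face C n i Neg (cmp C n i A B) = face C n i Neg A"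
    and face_Pos_cmp:
      "composable C n i A B \<Longrightarrow> face C n i Pos (cmp C n i A B) = face C n i Pos B"
    and cmp_assoc:
      "\<lbrakk>composable C n i A B; composable C n i B D\<rbrakk> \<Longrightarrow>
         cmp C n i (cmp C n i A B) D = cmp C n i A (cmp C n i B D)"
    and cmp_unit_right:
      "\<lbrakk>A \<in> cells C n; i \<in> {1..n}\<rbrakk> \<Longrightarrow>
         cmp C n i A (degen C (n - 1) i (face C n i Pos A)) = A"
    and cmp_unit_left:
      "\<lbrakk>A \<in> cells C n; i \<in> {1..n}\<rbrakk> \<Longrightarrow>
         cmp C n i (degen C (n - 1) i (face C n i Neg A)) A = A"
    and interchange:
      "\<lbrakk>i \<noteq> j; composable C n i A B; composable C n i D E;
        composable C n j A D; composable C n j B E\<rbrakk> \<Longrightarrow>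
         cmp C n j (cmp C n i A B) (cmp C n i D E) = cmp C n i (cmp C n j A D) (cmp C n j B E)"
    and degen_cmp:
      "\<lbrakk>composable C n j A B; i \<in> {1..n + 1}\<rbrakk> \<Longrightarrow>
         degen C n i (cmp C n j A B) = cmp C (n + 1) (up j i) (degen C n i A) (degen C n i B)"
    and conn_cmp:
      "\<lbrakk>composable C n j A B; i \<in> {1..n}; i \<noteq> j\<rbrakk> \<Longrightarrow>
         conn C n i \<alpha> (cmp C n j A B) = cmp C (n + 1) (up j i) (conn C n i \<alpha> A) (conn C n i \<alpha> B)"
    and conn_Neg_cmp:
      "composable C n i A B \<Longrightarrow>
         conn C n i Neg (cmp C n i A B) =
           cmp C (n + 1) (i + 1)
             (cmp C (n + 1) i (conn C n i Neg A) (degen C n (i + 1) B))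
             (cmp C (n + 1) i (degen C n i B) (conn C n i Neg B))"
    and conn_Pos_cmp:
      "composable C n i A B \<Longrightarrow>
         conn C n i Pos (cmp C n i A B) =
           cmp C (n + 1) (i + 1)
             (cmp C (n + 1) i (conn C n i Pos A) (degen C n i A))
             (cmp C (n + 1) i (degen C n (i + 1) A) (conn C n i Pos B))"
    and conn_cancel:
      "\<lbrakk>A \<in> cells C n; i \<in> {1..n}\<rbrakk> \<Longrightarrow>
         cmp C (n + 1) i (conn C n i Pos A) (conn C n i Neg A) = degen C n (i + 1) A"
    and conn_cancel_next:
      "\<lbrakk>A \<in> cells C n; i \<in> {1..n}\<rbrakk> \<Longrightarrow>
         cmp C (n + 1) (i + 1) (conn C n i Pos A) (conn C n i Neg A) = degen C n i A"

text \<open>Composability is required explicitly because \<^const>\<open>cmp\<close> is total.\<close>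

definition R_invertible :: "'a cubical \<Rightarrow> nat \<Rightarrow> nat \<Rightarrow> 'a \<Rightarrow> bool" where
  "R_invertible C n k A \<longleftrightarrow>
     (\<exists>B \<in> cells C n. composable C n k A B \<and> composable C n k B A \<and>
        cmp C n k A B = degen C (n - 1) k (face C n k Neg A) \<and>
        cmp C n k B A = degen C (n - 1) k (face C n k Pos A))"

definition psi :: "'a cubical \<Rightarrow> nat \<Rightarrow> nat \<Rightarrow> 'a \<Rightarrow> 'a" where
  "psi C n i A =
     cmp C n (i + 1)
       (cmp C n (i + 1) (conn C (n - 1) i Pos (face C n (i + 1) Neg A)) A)
       (conn C (n - 1) i Neg (face C n (i + 1) Pos A))"

text \<open>The fold is \<open>\<psi>\<^sub>1 (\<psi>\<^sub>2 (\<dots> (\<psi>\<^bsub>n-1\<^esub> A)))\<close>.\<close>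

definition invertible :: "'a cubical \<Rightarrow> nat \<Rightarrow> 'a \<Rightarrow> bool" where
  "invertible C n A \<longleftrightarrow> R_invertible C n 1 (foldr (psi C n) [1..<n] A)"

definition cubical_omega_p_category :: "nat \<Rightarrow> 'a cubical \<Rightarrow> bool" where
  "cubical_omega_p_category p C \<longleftrightarrow>
     cubical_omega_category C \<and> (\<forall>n > p. \<forall>A \<in> cells C n. invertible C n A)"

definition cubical_omega_groupoid :: "'a cubical \<Rightarrow> bool" where
  "cubical_omega_groupoid C \<longleftrightarrow> cubical_omega_p_category 0 C"

text \<open>The boundary conditions make all the composites in the two equations below composable.\<close>

definition is_T_inverse :: "'a cubical \<Rightarrow> nat \<Rightarrow> nat \<Rightarrow> 'a \<Rightarrow> 'a \<Rightarrow> bool" where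
  "is_T_inverse C n i A B \<longleftrightarrow>
     (\<forall>\<alpha>. face C n i \<alpha> A = face C n (i + 1) \<alpha> B \<and> face C n (i + 1) \<alpha> A = face C n i \<alpha> B) \<and>
     cmp C n (i + 1)
       (cmp C n i (conn C (n - 1) i Pos (face C n (i + 1) Neg A)) B)
       (cmp C n i A (conn C (n - 1) i Neg (face C n i Pos A)))
     = cmp C n i
         (conn C (n - 1) i Neg (face C n i Neg A))
         (conn C (n - 1) i Pos (face C n (i + 1) Pos A)) \<and>
     cmp C n (i + 1)
       (cmp C n i (conn C (n - 1) i Pos (face C n (i + 1) Neg B)) A)
       (cmp C n i B (conn C (n - 1) i Neg (face C n i Pos B)))
     = cmp C n i
         (conn C (n - 1) i Neg (face C n i Neg B))
         (conn C (n - 1) i Pos (face C n (i + 1) Pos B))"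

definition T_invertible :: "'a cubical \<Rightarrow> nat \<Rightarrow> nat \<Rightarrow> 'a \<Rightarrow> bool" where
  "T_invertible C n i A \<longleftrightarrow> (\<exists>B \<in> cells C n. is_T_inverse C n i A B)"

end

theory Submission
  imports Defs
begin

text \<open>
  In two adjacent directions \<open>i\<close>, \<open>i + 1\<close> the \<open>n\<close>-cells form a double category with connections
  whose edges are the \<open>(n - 1)\<close>-cells. There \<open>\<psi>\<^sub>i\<close> folds a square with edges
  \<open>N, S = \<partial>\<^sub>i\<^sup>-, \<partial>\<^sub>i\<^sup>+\<close> and \<open>W, E = \<partial>\<^bsub>i+1\<^esub>\<^sup>-, \<partial>\<^bsub>i+1\<^esub>\<^sup>+\<close> into a globular cell from \<open>N \<cdot> E\<close> to \<open>W \<cdot> S\<close>, and a square amounts to its boundary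
  together with its folding. The composition formulas for \<open>\<psi>\<^sub>i\<close> then show: a \<open>T\<^sub>i\<close>-inverse of \<open>A\<close> is
  the same as an \<open>R\<^sub>i\<close>-inverse of \<open>\<psi>\<^sub>i A\<close>; and from an \<open>R\<^sub>i\<close>-inverse of \<open>\<psi>\<^sub>i A\<close> one gets, by whiskering
  with inverses of edges, an \<open>R\<^sub>i\<close>-inverse of \<open>A\<close> if \<open>W\<close>, \<open>E\<close> are invertible and an
  \<open>R\<^bsub>i+1\<^esub>\<close>-inverse of \<open>A\<close> if \<open>N\<close>, \<open>S\<close> are.

  The theorem follows by induction on the dimension, which provides the invertible edges. Put
  \<open>A\<^sub>k = \<psi>\<^sub>k \<dots> \<psi>\<^bsub>n-1\<^esub> A\<close>. If \<open>A\<close> is invertible, climb from \<open>R\<^sub>1\<close>-invertibility of \<open>A\<^sub>1\<close> to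
  \<open>R\<^sub>k\<close>-invertibility of \<open>A\<^sub>k\<close>, up to \<open>k = n\<close> for (a) and \<open>k = n - 1\<close> for (b); then descend to the
  lower directions. In (b) the descent from \<open>T\<^bsub>i+1\<^esub>\<close> to \<open>T\<^sub>i\<close> uses that all \<open>n\<close>-cells, in particular
  \<open>\<psi>\<^sub>i A\<close>, are already known to be \<open>T\<^bsub>i+1\<^esub>\<close>-invertible.
\<close>

section \<open>Squares with connections\<close>

text \<open>Both kinds of edges come from one category, so a connection can carry the same edge on
  two adjacent sides: \<open>gp x\<close> on south and east, \<open>gm x\<close> on north and
  west.\<close>

locale double_category =
  fixes Sq :: "'s set" and Ed :: "'e set" and Ob :: "'o set"
    and src tgt :: "'e \<Rightarrow> 'o" and idn :: "'o \<Rightarrow> 'e"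
    and mul :: "'e \<Rightarrow> 'e \<Rightarrow> 'e" (infixl \<open>\<cdot>\<close> 75)
    and north south west east :: "'s \<Rightarrow> 'e"
    and e1 e2 gp gm :: "'e \<Rightarrow> 's"
    and vcmp :: "'s \<Rightarrow> 's \<Rightarrow> 's" (infixl \<open>\<ominus>\<close> 70)
    and hcmp :: "'s \<Rightarrow> 's \<Rightarrow> 's" (infixl \<open>\<oplus>\<close> 72)
  assumes ob [simp]: "x \<in> Ed \<Longrightarrow> src x \<in> Ob" "x \<in> Ed \<Longrightarrow> tgt x \<in> Ob"
    and idn [simp]: "a \<in> Ob \<Longrightarrow> idn a \<in> Ed" "a \<in> Ob \<Longrightarrow> src (idn a) = a" "a \<in> Ob \<Longrightarrow> tgt (idn a) = a"
    and mul [simp]: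
      "\<lbrakk>x \<in> Ed; y \<in> Ed; tgt x = src y\<rbrakk> \<Longrightarrow> x \<cdot> y \<in> Ed"
      "\<lbrakk>x \<in> Ed; y \<in> Ed; tgt x = src y\<rbrakk> \<Longrightarrow> src (x \<cdot> y) = src x"
      "\<lbrakk>x \<in> Ed; y \<in> Ed; tgt x = src y\<rbrakk> \<Longrightarrow> tgt (x \<cdot> y) = tgt y"
    and mul_assoc:
      "\<lbrakk>x \<in> Ed; y \<in> Ed; z \<in> Ed; tgt x = src y; tgt y = src z\<rbrakk> \<Longrightarrow> x \<cdot> y \<cdot> z = x \<cdot> (y \<cdot> z)"
    and mul_idn: "x \<in> Ed \<Longrightarrow> x \<cdot> idn (tgt x) = x" "x \<in> Ed \<Longrightarrow> idn (src x) \<cdot> x = x"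
    and ed [simp]: "A \<in> Sq \<Longrightarrow> north A \<in> Ed" "A \<in> Sq \<Longrightarrow> south A \<in> Ed"
      "A \<in> Sq \<Longrightarrow> west A \<in> Ed" "A \<in> Sq \<Longrightarrow> east A \<in> Ed"
    and corners [simp]: "A \<in> Sq \<Longrightarrow> src (west A) = src (north A)" "A \<in> Sq \<Longrightarrow> tgt (west A) = src (south A)"
      "A \<in> Sq \<Longrightarrow> src (east A) = tgt (north A)" "A \<in> Sq \<Longrightarrow> tgt (east A) = tgt (south A)"
    and e1 [simp]: "x \<in> Ed \<Longrightarrow> e1 x \<in> Sq" "x \<in> Ed \<Longrightarrow> north (e1 x) = x" "x \<in> Ed \<Longrightarrow> south (e1 x) = x"
      "x \<in> Ed \<Longrightarrow> west (e1 x) = idn (src x)" "x \<in> Ed \<Longrightarrow> east (e1 x) = idn (tgt x)"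
    and e2 [simp]: "x \<in> Ed \<Longrightarrow> e2 x \<in> Sq" "x \<in> Ed \<Longrightarrow> west (e2 x) = x" "x \<in> Ed \<Longrightarrow> east (e2 x) = x"
      "x \<in> Ed \<Longrightarrow> north (e2 x) = idn (src x)" "x \<in> Ed \<Longrightarrow> south (e2 x) = idn (tgt x)"
    and gp [simp]: "x \<in> Ed \<Longrightarrow> gp x \<in> Sq" "x \<in> Ed \<Longrightarrow> south (gp x) = x" "x \<in> Ed \<Longrightarrow> east (gp x) = x"
      "x \<in> Ed \<Longrightarrow> north (gp x) = idn (src x)" "x \<in> Ed \<Longrightarrow> west (gp x) = idn (src x)"
    and gm [simp]: "x \<in> Ed \<Longrightarrow> gm x \<in> Sq" "x \<in> Ed \<Longrightarrow> north (gm x) = x" "x \<in> Ed \<Longrightarrow> west (gm x) = x"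
      "x \<in> Ed \<Longrightarrow> south (gm x) = idn (tgt x)" "x \<in> Ed \<Longrightarrow> east (gm x) = idn (tgt x)"
    and vcmp [simp]:
      "\<lbrakk>A \<in> Sq; B \<in> Sq; south A = north B\<rbrakk> \<Longrightarrow> A \<ominus> B \<in> Sq"
      "\<lbrakk>A \<in> Sq; B \<in> Sq; south A = north B\<rbrakk> \<Longrightarrow> north (A \<ominus> B) = north A"
      "\<lbrakk>A \<in> Sq; B \<in> Sq; south A = north B\<rbrakk> \<Longrightarrow> south (A \<ominus> B) = south B"
      "\<lbrakk>A \<in> Sq; B \<in> Sq; south A = north B\<rbrakk> \<Longrightarrow> west (A \<ominus> B) = west A \<cdot> west B"
      "\<lbrakk>A \<in> Sq; B \<in> Sq; south A = north B\<rbrakk> \<Longrightarrow> east (A \<ominus> B) = east A \<cdot> east B"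
    and hcmp [simp]:
      "\<lbrakk>A \<in> Sq; B \<in> Sq; east A = west B\<rbrakk> \<Longrightarrow> A \<oplus> B \<in> Sq"
      "\<lbrakk>A \<in> Sq; B \<in> Sq; east A = west B\<rbrakk> \<Longrightarrow> west (A \<oplus> B) = west A"
      "\<lbrakk>A \<in> Sq; B \<in> Sq; east A = west B\<rbrakk> \<Longrightarrow> east (A \<oplus> B) = east B"
      "\<lbrakk>A \<in> Sq; B \<in> Sq; east A = west B\<rbrakk> \<Longrightarrow> north (A \<oplus> B) = north A \<cdot> north B"
      "\<lbrakk>A \<in> Sq; B \<in> Sq; east A = west B\<rbrakk> \<Longrightarrow> south (A \<oplus> B) = south A \<cdot> south B"
    and vcmp_assoc:
      "\<lbrakk>A \<in> Sq; B \<in> Sq; D \<in> Sq; south A = north B; south B = north D\<rbrakk> \<Longrightarrow> A \<ominus> B \<ominus> D = A \<ominus> (B \<ominus> D)"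
    and hcmp_assoc:
      "\<lbrakk>A \<in> Sq; B \<in> Sq; D \<in> Sq; east A = west B; east B = west D\<rbrakk> \<Longrightarrow> A \<oplus> B \<oplus> D = A \<oplus> (B \<oplus> D)"
    and vcmp_unit: "A \<in> Sq \<Longrightarrow> A \<ominus> e1 (south A) = A" "A \<in> Sq \<Longrightarrow> e1 (north A) \<ominus> A = A"
    and hcmp_unit: "A \<in> Sq \<Longrightarrow> A \<oplus> e2 (east A) = A" "A \<in> Sq \<Longrightarrow> e2 (west A) \<oplus> A = A"
    and interchange:
      "\<lbrakk>A \<in> Sq; B \<in> Sq; D \<in> Sq; E \<in> Sq; south A = north D; south B = north E;
        east A = west B; east D = west E\<rbrakk> \<Longrightarrow> (A \<oplus> B) \<ominus> (D \<oplus> E) = (A \<ominus> D) \<oplus> (B \<ominus> E)"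
    and e1_mul: "\<lbrakk>x \<in> Ed; y \<in> Ed; tgt x = src y\<rbrakk> \<Longrightarrow> e1 (x \<cdot> y) = e1 x \<oplus> e1 y"
    and e2_idn: "a \<in> Ob \<Longrightarrow> e2 (idn a) = e1 (idn a)"
    and gp_idn [simp]: "a \<in> Ob \<Longrightarrow> gp (idn a) = e1 (idn a)"
    and gm_idn [simp]: "a \<in> Ob \<Longrightarrow> gm (idn a) = e1 (idn a)"
    and gp_mul: "\<lbrakk>x \<in> Ed; y \<in> Ed; tgt x = src y\<rbrakk> \<Longrightarrow>
      gp (x \<cdot> y) = (gp x \<ominus> e1 x) \<oplus> (e2 x \<ominus> gp y)"
    and gm_mul: "\<lbrakk>x \<in> Ed; y \<in> Ed; tgt x = src y\<rbrakk> \<Longrightarrow>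
      gm (x \<cdot> y) = (gm x \<ominus> e2 y) \<oplus> (e1 y \<ominus> gm y)"
    and gp_vcmp_gm: "x \<in> Ed \<Longrightarrow> gp x \<ominus> gm x = e2 x"
    and gp_hcmp_gm: "x \<in> Ed \<Longrightarrow> gp x \<oplus> gm x = e1 x"
begin

section \<open>Units, and connections in row form\<close>

lemma mul_idn' [simp]:
  "\<lbrakk>x \<in> Ed; tgt x = a\<rbrakk> \<Longrightarrow> x \<cdot> idn a = x"
  "\<lbrakk>x \<in> Ed; src x = a\<rbrakk> \<Longrightarrow> idn a \<cdot> x = x"
  using mul_idn by auto

lemma vcmp_e1 [simp]:
  "\<lbrakk>A \<in> Sq; south A = x\<rbrakk> \<Longrightarrow> A \<ominus> e1 x = A"
  "\<lbrakk>A \<in> Sq; north A = x\<rbrakk> \<Longrightarrow> e1 x \<ominus> A = A"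
  using vcmp_unit by auto

lemma hcmp_e2 [simp]:
  "\<lbrakk>A \<in> Sq; east A = x\<rbrakk> \<Longrightarrow> A \<oplus> e2 x = A"
  "\<lbrakk>A \<in> Sq; west A = x\<rbrakk> \<Longrightarrow> e2 x \<oplus> A = A"
  using hcmp_unit by auto

text \<open>By \<open>e2_idn\<close> the two degenerate squares on an identity edge coincide, so
  \<open>e1 (idn a)\<close> is a unit for \<open>\<oplus>\<close> as well.\<close>

lemma hcmp_e1_idn [simp]:
  "\<lbrakk>A \<in> Sq; a \<in> Ob; east A = idn a\<rbrakk> \<Longrightarrow> A \<oplus> e1 (idn a) = A"
  "\<lbrakk>A \<in> Sq; a \<in> Ob; west A = idn a\<rbrakk> \<Longrightarrow> e1 (idn a) \<oplus> A = A"
  by (metis e2_idn hcmp_unit(1)) (metis e2_idn hcmp_unit(2))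

text \<open>Interchange turns the columns of \<open>gp_mul\<close> into rows, which is the form
  needed to fold vertical composites.\<close>

lemma gp_mul_rows:
  assumes "x \<in> Ed" "y \<in> Ed" "tgt x = src y"
  shows "gp (x \<cdot> y) = gp x \<ominus> (e1 x \<oplus> gp y)"
proof -
  have "gp (x \<cdot> y) = (gp x \<oplus> e2 x) \<ominus> (e1 x \<oplus> gp y)"
    using assms by (subst interchange) (simp_all add: gp_mul)
  then show ?thesis using assms by simp
qed

lemma gm_mul_rows:
  assumes "x \<in> Ed" "y \<in> Ed" "tgt x = src y"
  shows "gm (x \<cdot> y) = (gm x \<oplus> e1 y) \<ominus> gm y"
proof -
  have "gm (x \<cdot> y) = (gm x \<oplus> e1 y) \<ominus> (e2 y \<oplus> gm y)"
    using assms by (subst interchange) (simp_all add: gm_mul)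
  then show ?thesis using assms by simp
qed

section \<open>Folding and unfolding of squares\<close>

definition fold :: "'s \<Rightarrow> 's" where
  "fold A = gp (west A) \<oplus> A \<oplus> gm (east A)"

lemma fold [simp]:
  assumes "A \<in> Sq"
  shows "fold A \<in> Sq" "north (fold A) = north A \<cdot> east A" "south (fold A) = west A \<cdot> south A"
    "west (fold A) = idn (src (north A))" "east (fold A) = idn (tgt (south A))"
  using assms by (simp_all add: fold_def)

text \<open>The upper row moves \<open>e\<close> from the north edge of \<open>W\<close> to the east
  side, the lower row moves \<open>w\<close> from its south edge to the west side.\<close>

definition unfold :: "'e \<Rightarrow> 'e \<Rightarrow> 'e \<Rightarrow> 'e \<Rightarrow> 's \<Rightarrow> 's" where
  "unfold n s w e W = (e1 n \<oplus> gp e) \<ominus> W \<ominus> (gm w \<oplus> e1 s)"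

text \<open>Interchange puts \<open>gp\<close> above \<open>gm\<close>, first on the east edge and
  then on the west edge; by \<open>gp_vcmp_gm\<close> each pair is a unit for
  \<open>\<oplus>\<close>.\<close>

lemma unfold_fold:
  assumes A: "A \<in> Sq"
  shows "unfold (north A) (south A) (west A) (east A) (fold A) = A"
proof -
  let ?U = "gp (west A) \<oplus> A"
  have "(e1 (north A) \<oplus> gp (east A)) \<ominus> (?U \<oplus> gm (east A)) = ?U"
    using A by (subst interchange) (simp_all add: gp_vcmp_gm)
  moreover have "?U \<ominus> (gm (west A) \<oplus> e1 (south A)) = A"
    using A by (subst interchange) (simp_all add: gp_vcmp_gm)
  ultimately show ?thesis by (simp add: unfold_def fold_def)
qed

text \<open>Squares with a common boundary are recovered from their foldings by the same
  \<open>unfold\<close>. Equations between squares are proved below through their foldings.\<close>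

lemma fold_inj:
  assumes "A \<in> Sq" "B \<in> Sq" "north A = north B" "south A = south B" "west A = west B" "east A = east B"
    "fold A = fold B"
  shows "A = B"
  using assms unfold_fold by metis

lemma fold_unfold:
  assumes x: "n \<in> Ed" "s \<in> Ed" "w \<in> Ed" "e \<in> Ed"
    and c: "src w = src n" "tgt w = src s" "src e = tgt n" "tgt e = tgt s"
    and W: "W \<in> Sq" "north W = n \<cdot> e" "south W = w \<cdot> s" "west W = idn (src n)" "east W = idn (tgt s)"
  shows "unfold n s w e W \<in> Sq"
    "north (unfold n s w e W) = n" "south (unfold n s w e W) = s"
    "west (unfold n s w e W) = w" "east (unfold n s w e W) = e"
    "fold (unfold n s w e W) = W"
proof -
  let ?P = "e1 n \<oplus> gp e" and ?Q = "gm w \<oplus> e1 s"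
  note [simp] = x c W
  have Z: "unfold n s w e W = ?P \<ominus> (W \<ominus> ?Q)"
    unfolding unfold_def by (subst vcmp_assoc) simp_all
  show Zs: "unfold n s w e W \<in> Sq"
    "north (unfold n s w e W) = n" "south (unfold n s w e W) = s"
    "west (unfold n s w e W) = w" "east (unfold n s w e W) = e"
    by (simp_all add: Z)
  \<comment> \<open>The column \<open>gm e\<close> is padded below by an identity square, so that it
    splits into two rows; in the upper one \<open>gp e\<close> meets \<open>gm e\<close>.\<close>
  have "(?P \<ominus> (W \<ominus> ?Q)) \<oplus> (gm e \<ominus> e1 (idn (tgt s))) = (?P \<oplus> gm e) \<ominus> ((W \<ominus> ?Q) \<oplus> e1 (idn (tgt s)))"
    by (subst interchange) simp_all
  also have "?P \<oplus> gm e = e1 (n \<cdot> e)"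
    by (subst hcmp_assoc) (simp_all add: gp_hcmp_gm e1_mul)
  finally have 1: "unfold n s w e W \<oplus> gm e = W \<ominus> ?Q"
    by (simp add: Z)
  have "(e1 (idn (src n)) \<ominus> gp w) \<oplus> (W \<ominus> ?Q) = (e1 (idn (src n)) \<oplus> W) \<ominus> (gp w \<oplus> ?Q)"
    by (subst interchange) simp_all
  also have "gp w \<oplus> ?Q = e1 (w \<cdot> s)"
    by (subst hcmp_assoc[symmetric]) (simp_all add: gp_hcmp_gm e1_mul)
  finally have 2: "gp w \<oplus> (W \<ominus> ?Q) = W"
    by simp
  show "fold (unfold n s w e W) = W"
    unfolding fold_def using Zs by (subst hcmp_assoc) (simp_all add: 1 2)
qed

text \<open>The connections on the composite west and east edges split into rows, and interchange
  separates the rows of \<open>A\<close> from those of \<open>B\<close>.\<close>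

lemma fold_vcmp:
  assumes "A \<in> Sq" "B \<in> Sq" "south A = north B"
  shows "fold (A \<ominus> B) = (fold A \<oplus> e1 (east B)) \<ominus> (e1 (west A) \<oplus> fold B)"
proof -
  note [simp] = assms
  let ?g = "gm (east A) \<oplus> e1 (east B)" and ?h = "e1 (west A) \<oplus> gp (west B)"
  have "fold (A \<ominus> B) = (gp (west A) \<ominus> ?h) \<oplus> (A \<ominus> B) \<oplus> (?g \<ominus> gm (east B))"
    by (simp add: fold_def gp_mul_rows gm_mul_rows)
  also have "(gp (west A) \<ominus> ?h) \<oplus> (A \<ominus> B) = (gp (west A) \<oplus> A) \<ominus> (?h \<oplus> B)"
    by (subst interchange) simp_all
  also have "((gp (west A) \<oplus> A) \<ominus> (?h \<oplus> B)) \<oplus> (?g \<ominus> gm (east B))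
      = ((gp (west A) \<oplus> A) \<oplus> ?g) \<ominus> ((?h \<oplus> B) \<oplus> gm (east B))"
    by (subst interchange) simp_all
  finally show ?thesis
    by (simp add: fold_def hcmp_assoc)
qed

text \<open>Stacking the foldings puts \<open>gp x\<close> above \<open>gm x\<close> for the common
  edge \<open>x\<close>, and these compose to the unit \<open>e2 x\<close>. For this the folding of
  the right-hand square has to be on top.\<close>

lemma fold_hcmp:
  assumes "A \<in> Sq" "B \<in> Sq" "east A = west B"
  shows "fold (A \<oplus> B) = (e1 (north A) \<oplus> fold B) \<ominus> (fold A \<oplus> e1 (south B))"
proof -
  note [simp] = assms
  have [simp]: "tgt (north A) = src (north B)" "tgt (south A) = src (south B)"
    using corners[OF assms(1)] corners[OF assms(2)] by simp_all
  let ?U = "gp (west A) \<oplus> A" and ?V = "B \<oplus> gm (east B)" and ?x = "west B"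
  have "(e1 (north A) \<oplus> fold B) \<ominus> (fold A \<oplus> e1 (south B))
      = (e1 (north A) \<oplus> (gp ?x \<oplus> ?V)) \<ominus> (?U \<oplus> (gm ?x \<oplus> e1 (south B)))"
    by (simp add: fold_def hcmp_assoc)
  also have "\<dots> = (e1 (north A) \<ominus> ?U) \<oplus> ((gp ?x \<oplus> ?V) \<ominus> (gm ?x \<oplus> e1 (south B)))"
    by (subst interchange) simp_all
  also have "(gp ?x \<oplus> ?V) \<ominus> (gm ?x \<oplus> e1 (south B)) = (gp ?x \<ominus> gm ?x) \<oplus> (?V \<ominus> e1 (south B))"
    by (subst interchange) simp_all
  also have "(e1 (north A) \<ominus> ?U) \<oplus> \<dots> = fold (A \<oplus> B)"
    by (simp add: gp_vcmp_gm fold_def hcmp_assoc)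
  finally show ?thesis ..
qed

lemma fold_degenerate [simp]:
  assumes "x \<in> Ed"
  shows "fold (e1 x) = e1 x" "fold (e2 x) = e1 x" "fold (gp x) = e1 x" "fold (gm x) = e1 x"
  using assms by (simp_all add: fold_def gp_hcmp_gm)

section \<open>Inverses of edges and squares\<close>

definition edge_inverse :: "'e \<Rightarrow> 'e \<Rightarrow> bool" where
  "edge_inverse x y \<longleftrightarrow> x \<in> Ed \<and> y \<in> Ed \<and> tgt x = src y \<and> tgt y = src x \<and>
     x \<cdot> y = idn (src x) \<and> y \<cdot> x = idn (src y)"

definition vinverse :: "'s \<Rightarrow> 's \<Rightarrow> bool" where
  "vinverse A B \<longleftrightarrow> A \<in> Sq \<and> B \<in> Sq \<and> south A = north B \<and> south B = north A \<and>
     A \<ominus> B = e1 (north A) \<and> B \<ominus> A = e1 (north B)"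

definition hinverse :: "'s \<Rightarrow> 's \<Rightarrow> bool" where
  "hinverse A B \<longleftrightarrow> A \<in> Sq \<and> B \<in> Sq \<and> east A = west B \<and> east B = west A \<and>
     A \<oplus> B = e2 (west A) \<and> B \<oplus> A = e2 (west B)"

text \<open>The boundary of \<open>B\<close> is that of \<open>A\<close> reflected in the diagonal;
  the two equations are those of a \<open>T\<close>-inverse in square notation.\<close>

definition tinverse :: "'s \<Rightarrow> 's \<Rightarrow> bool" where
  "tinverse A B \<longleftrightarrow> A \<in> Sq \<and> B \<in> Sq \<and>
     north A = west B \<and> west A = north B \<and> south A = east B \<and> east A = south B \<and>
     (gp (west A) \<ominus> B) \<oplus> (A \<ominus> gm (south A)) = gm (north A) \<ominus> gp (east A) \<and>
     (gp (west B) \<ominus> A) \<oplus> (B \<ominus> gm (south B)) = gm (north B) \<ominus> gp (east B)"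

lemma edge_inverseD:
  assumes "edge_inverse x y"
  shows "x \<in> Ed" "y \<in> Ed" "src y = tgt x" "tgt y = src x" "x \<cdot> y = idn (src x)" "y \<cdot> x = idn (tgt x)"
  using assms by (auto simp: edge_inverse_def)

lemma edge_inverse_sym: "edge_inverse x y \<longleftrightarrow> edge_inverse y x"
  by (auto simp: edge_inverse_def)

lemma mul_cancel:
  assumes "edge_inverse x y" "z \<in> Ed" "src z = src x"
  shows "x \<cdot> (y \<cdot> z) = z"
  using assms by (simp add: edge_inverse_def flip: mul_assoc)

lemma e1_cancel_left:
  assumes "edge_inverse x y" "Z \<in> Sq" "west Z = idn (src x)"
  shows "e1 x \<oplus> (e1 y \<oplus> Z) = Z"
proof -
  note [simp] = edge_inverseD[OF assms(1)] assms(2,3)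
  have "e1 x \<oplus> (e1 y \<oplus> Z) = e1 (x \<cdot> y) \<oplus> Z"
    by (subst e1_mul) (simp_all add: hcmp_assoc del: edge_inverseD(5)[OF assms(1)])
  then show ?thesis by simp
qed

lemma e1_cancel_right:
  assumes "edge_inverse x y" "Z \<in> Sq" "east Z = idn (src x)"
  shows "Z \<oplus> e1 x \<oplus> e1 y = Z"
proof -
  note [simp] = edge_inverseD[OF assms(1)] assms(2,3)
  have "Z \<oplus> e1 x \<oplus> e1 y = Z \<oplus> e1 (x \<cdot> y)"
    by (subst e1_mul) (simp_all add: hcmp_assoc del: edge_inverseD(5)[OF assms(1)])
  then show ?thesis by simp
qed

text \<open>Obtained from the north and south edges of the two unit equations.\<close>

lemma hinverse_edges:
  assumes "hinverse A B"
  shows "edge_inverse (north A) (north B)" "edge_inverse (south A) (south B)"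
proof -
  have AB: "A \<in> Sq" "B \<in> Sq" "east A = west B" "east B = west A"
    "A \<oplus> B = e2 (west A)" "B \<oplus> A = e2 (west B)"
    using assms by (auto simp: hinverse_def)
  have c: "tgt (north A) = src (north B)" "tgt (south A) = src (south B)"
    "tgt (north B) = src (north A)" "tgt (south B) = src (south A)"
    using corners[OF AB(1)] corners[OF AB(2)] AB(3,4) by simp_all
  show "edge_inverse (north A) (north B)" "edge_inverse (south A) (south B)"
    using AB(1,2) c hcmp(4,5)[OF AB(1-3)] hcmp(4,5)[OF AB(2,1,4)] AB(5,6)
    by (simp_all add: edge_inverse_def)
qed

text \<open>Naming the edges lets simplification reduce every boundary to variables.\<close>

definition square :: "'e \<Rightarrow> 'e \<Rightarrow> 'e \<Rightarrow> 'e \<Rightarrow> 's \<Rightarrow> bool" where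
  "square n s w e A \<longleftrightarrow> A \<in> Sq \<and> north A = n \<and> south A = s \<and> west A = w \<and> east A = e"

lemma square_self: "A \<in> Sq \<Longrightarrow> square (north A) (south A) (west A) (east A) A"
  by (simp add: square_def)

lemma squareD:
  assumes "square n s w e A"
  shows "A \<in> Sq" "north A = n" "south A = s" "west A = w" "east A = e"
    "n \<in> Ed" "s \<in> Ed" "w \<in> Ed" "e \<in> Ed"
    "src w = src n" "tgt w = src s" "src e = tgt n" "tgt e = tgt s"
  using assms by (auto simp: square_def)

text \<open>The west and east edges of \<open>Y\<close> are forced: those of \<open>fold A\<close>
  and of \<open>fold A \<ominus> Y\<close> are identities.\<close>

lemma fold_vinverseD:
  assumes A: "square n s w e A" and Y: "vinverse (fold A) Y"
  shows "Y \<in> Sq" "north Y = w \<cdot> s" "south Y = n \<cdot> e" "west Y = idn (src n)" "east Y = idn (tgt s)"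
    "fold A \<ominus> Y = e1 (n \<cdot> e)" "Y \<ominus> fold A = e1 (w \<cdot> s)"
proof -
  note [simp] = squareD[OF A]
  show Y': "Y \<in> Sq" "north Y = w \<cdot> s" "south Y = n \<cdot> e"
    and FY: "fold A \<ominus> Y = e1 (n \<cdot> e)" "Y \<ominus> fold A = e1 (w \<cdot> s)"
    using Y by (auto simp: vinverse_def)
  have "west (fold A \<ominus> Y) = west Y" "east (fold A \<ominus> Y) = east Y"
    using Y' by simp_all
  with FY show "west Y = idn (src n)" "east Y = idn (tgt s)"
    by simp_all
qed

lemma vinverse_if_fold:
  assumes A: "square n s w e A" and w: "edge_inverse w w'" and e: "edge_inverse e e'"
    and Y: "vinverse (fold A) Y"
  shows "\<exists>B. vinverse A B"
proof -
  note w' = w[unfolded edge_inverse_sym[of w]] and e' = e[unfolded edge_inverse_sym[of e]]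
  note [simp] = squareD[OF A] fold_vinverseD[OF A Y] edge_inverseD[OF w] edge_inverseD[OF e]
  note [simp] = mul_assoc mul_cancel[OF w] mul_cancel[OF e] mul_cancel[OF w'] mul_cancel[OF e']
  \<comment> \<open>Whiskering turns the north edge \<open>w \<cdot> s\<close> of \<open>Y\<close>
    into \<open>s \<cdot> e'\<close> and the south edge \<open>n \<cdot> e\<close> into
    \<open>w' \<cdot> n\<close>. This is the boundary of the folding of a square with edges
    \<open>s\<close>, \<open>n\<close>, \<open>w'\<close>, \<open>e'\<close>, as a vertical inverse
    of \<open>A\<close> must have.\<close>
  define W where "W = e1 w' \<oplus> (Y \<oplus> e1 e')"
  have [simp]: "W \<in> Sq" "north W = s \<cdot> e'" "south W = w' \<cdot> n" "west W = idn (src s)" "east W = idn (tgt n)"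
    by (simp_all add: W_def)
  define B where "B = unfold s n w' e' W"
  have [simp]: "B \<in> Sq" "north B = s" "south B = n" "west B = w'" "east B = e'" "fold B = W"
    unfolding B_def by (rule fold_unfold; simp)+
  have "A \<ominus> B = e1 n"
  proof (rule fold_inj)
    have "fold (A \<ominus> B) = (fold A \<oplus> e1 e') \<ominus> (Y \<oplus> e1 e')"
      by (simp add: fold_vcmp W_def e1_cancel_left[OF w])
    also have "\<dots> = e1 (n \<cdot> e) \<oplus> e1 e'"
      by (subst interchange) simp_all
    also have "\<dots> = e1 n"
      by (simp flip: e1_mul)
    finally show "fold (A \<ominus> B) = fold (e1 n)"
      by simp
  qed simp_all
  moreover have "B \<ominus> A = e1 s"
  proof (rule fold_inj)
    have "fold (B \<ominus> A) = (e1 w' \<oplus> Y) \<ominus> (e1 w' \<oplus> fold A)"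
      by (simp add: fold_vcmp W_def e1_cancel_right[OF e'] flip: hcmp_assoc)
    also have "\<dots> = e1 w' \<oplus> e1 (w \<cdot> s)"
      by (subst interchange) simp_all
    also have "\<dots> = e1 s"
      by (simp flip: e1_mul)
    finally show "fold (B \<ominus> A) = fold (e1 s)"
      by simp
  qed simp_all
  ultimately have "vinverse A B"
    by (simp add: vinverse_def)
  then show ?thesis ..
qed

lemma hinverse_if_fold:
  assumes A: "square n s w e A" and n: "edge_inverse n n'" and s: "edge_inverse s s'"
    and Y: "vinverse (fold A) Y"
  shows "\<exists>B. hinverse A B"
proof -
  note n' = n[unfolded edge_inverse_sym[of n]] and s' = s[unfolded edge_inverse_sym[of s]]
  note [simp] = squareD[OF A] fold_vinverseD[OF A Y] edge_inverseD[OF n] edge_inverseD[OF s]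
  note [simp] = mul_assoc mul_cancel[OF n] mul_cancel[OF s] mul_cancel[OF n'] mul_cancel[OF s']
  \<comment> \<open>Now the whiskered edges are \<open>n' \<cdot> w\<close> and
    \<open>e \<cdot> s'\<close>, which fits the folding of a horizontal inverse, with edges
    \<open>n'\<close>, \<open>s'\<close>, \<open>e\<close>, \<open>w\<close>.\<close>
  define W where "W = e1 n' \<oplus> (Y \<oplus> e1 s')"
  have [simp]: "W \<in> Sq" "north W = n' \<cdot> w" "south W = e \<cdot> s'" "west W = idn (tgt n)" "east W = idn (src s)"
    by (simp_all add: W_def)
  define B where "B = unfold n' s' e w W"
  have [simp]: "B \<in> Sq" "north B = n'" "south B = s'" "west B = e" "east B = w" "fold B = W"
    unfolding B_def by (rule fold_unfold; simp)+
  have "A \<oplus> B = e2 w"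
  proof (rule fold_inj)
    have "fold (A \<oplus> B) = (Y \<oplus> e1 s') \<ominus> (fold A \<oplus> e1 s')"
      by (simp add: fold_hcmp W_def e1_cancel_left[OF n])
    also have "\<dots> = e1 (w \<cdot> s) \<oplus> e1 s'"
      by (subst interchange) simp_all
    also have "\<dots> = e1 w"
      by (simp flip: e1_mul)
    finally show "fold (A \<oplus> B) = fold (e2 w)"
      by simp
  qed simp_all
  moreover have "B \<oplus> A = e2 e"
  proof (rule fold_inj)
    have "fold (B \<oplus> A) = (e1 n' \<oplus> fold A) \<ominus> (e1 n' \<oplus> Y)"
      by (simp add: fold_hcmp W_def e1_cancel_right[OF s'] flip: hcmp_assoc)
    also have "\<dots> = e1 n' \<oplus> e1 (n \<cdot> e)"
      by (subst interchange) simp_all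
    also have "\<dots> = e1 e"
      by (simp flip: e1_mul)
    finally show "fold (B \<oplus> A) = fold (e2 e)"
      by simp
  qed simp_all
  ultimately have "hinverse A B"
    by (simp add: hinverse_def)
  then show ?thesis ..
qed

lemma fold_vinverse_if_hinverse:
  assumes "hinverse A B"
  shows "\<exists>Y. vinverse (fold A) Y"
proof -
  have "A \<in> Sq" "B \<in> Sq" and "east A = west B" "east B = west A"
    and AB: "A \<oplus> B = e2 (west A)" and BA: "B \<oplus> A = e2 (west B)"
    using assms by (auto simp: hinverse_def)
  then obtain n s w e n' s' where A: "square n s w e A" and B: "square n' s' e w B"
    using square_self by metis
  have n: "edge_inverse n n'" and s: "edge_inverse s s'"
    using hinverse_edges[OF assms] squareD[OF A] squareD[OF B] by simp_all
  note n' = n[unfolded edge_inverse_sym[of n]] and s' = s[unfolded edge_inverse_sym[of s]]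
  note [simp] = squareD[OF A] squareD(1-5)[OF B] edge_inverseD[OF n] edge_inverseD[OF s]
  note [simp] = mul_assoc mul_cancel[OF n] mul_cancel[OF s] mul_cancel[OF n'] mul_cancel[OF s']
  \<comment> \<open>Undoes the whiskering by \<open>n'\<close> and \<open>s'\<close> through which
    \<open>fold B\<close> arises from an inverse of \<open>fold A\<close>.\<close>
  define Y where "Y = e1 n \<oplus> (fold B \<oplus> e1 s)"
  have 1: "(e1 n \<oplus> fold B) \<ominus> (fold A \<oplus> e1 s') = e1 w"
    using arg_cong[OF AB, of fold] by (simp add: fold_hcmp)
  have 2: "(e1 n' \<oplus> fold A) \<ominus> (fold B \<oplus> e1 s) = e1 e"
    using arg_cong[OF BA, of fold] by (simp add: fold_hcmp)
  have [simp]: "Y \<in> Sq" "north Y = w \<cdot> s" "south Y = n \<cdot> e"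
    by (simp_all add: Y_def)
  have "Y \<ominus> fold A = ((e1 n \<oplus> fold B) \<oplus> e1 s) \<ominus> ((fold A \<oplus> e1 s') \<oplus> e1 s)"
    by (simp add: Y_def e1_cancel_right[OF s'] hcmp_assoc[of "e1 n"])
  also have "\<dots> = e1 (w \<cdot> s)"
    by (subst interchange) (simp_all add: 1 e1_mul)
  finally have "Y \<ominus> fold A = e1 (w \<cdot> s)" .
  moreover have "fold A \<ominus> Y = (e1 n \<oplus> (e1 n' \<oplus> fold A)) \<ominus> (e1 n \<oplus> (fold B \<oplus> e1 s))"
    by (simp add: Y_def e1_cancel_left[OF n])
  then have "fold A \<ominus> Y = e1 (n \<cdot> e)"
    by (subst (asm) interchange) (simp_all add: 2 e1_mul)
  ultimately have "vinverse (fold A) Y"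
    by (simp add: vinverse_def)
  then show ?thesis ..
qed

text \<open>Connections fold to units and drop out; the reversed order in \<open>fold_hcmp\<close>
  leaves \<open>fold A\<close> on top.\<close>

lemma fold_tinverse:
  assumes A: "square n s w e A" and B: "square w e n s B"
  shows "fold ((gp w \<ominus> B) \<oplus> (A \<ominus> gm s)) = fold A \<ominus> fold B"
    "fold (gm n \<ominus> gp e) = e1 (n \<cdot> e)"
proof -
  note [simp] = squareD[OF A] squareD(1-5)[OF B]
  have [simp]: "fold (gp w \<ominus> B) = fold B" "fold (A \<ominus> gm s) = fold A"
    by (simp_all add: fold_vcmp flip: e1_mul)
  show "fold ((gp w \<ominus> B) \<oplus> (A \<ominus> gm s)) = fold A \<ominus> fold B"
    by (simp add: fold_hcmp)
  show "fold (gm n \<ominus> gp e) = e1 (n \<cdot> e)"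
    by (simp add: fold_vcmp flip: e1_mul)
qed

text \<open>In each equation for a \<open>T\<close>-inverse both sides have the same boundary, so by
  \<open>fold_inj\<close> it may be compared after folding.\<close>

lemma tinverse_iff_fold:
  assumes A: "square n s w e A" and B: "square w e n s B"
  shows "tinverse A B \<longleftrightarrow> vinverse (fold A) (fold B)"
proof -
  note [simp] = squareD[OF A] squareD(1-5)[OF B]
  have "(gp w \<ominus> B) \<oplus> (A \<ominus> gm s) = gm n \<ominus> gp e \<longleftrightarrow>
      fold ((gp w \<ominus> B) \<oplus> (A \<ominus> gm s)) = fold (gm n \<ominus> gp e)"
    by (rule iffI, simp, rule fold_inj) simp_all
  moreover have "(gp n \<ominus> A) \<oplus> (B \<ominus> gm e) = gm w \<ominus> gp s \<longleftrightarrow>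
      fold ((gp n \<ominus> A) \<oplus> (B \<ominus> gm e)) = fold (gm w \<ominus> gp s)"
    by (rule iffI, simp, rule fold_inj) simp_all
  ultimately show ?thesis
    by (simp add: tinverse_def vinverse_def fold_tinverse[OF A B] fold_tinverse[OF B A])
qed

lemma ex_tinverse_iff:
  assumes "A \<in> Sq"
  shows "(\<exists>B. tinverse A B) \<longleftrightarrow> (\<exists>Y. vinverse (fold A) Y)"
proof
  assume "\<exists>B. tinverse A B"
  then obtain B where B: "tinverse A B" ..
  then have "square (west A) (east A) (north A) (south A) B"
    by (auto simp: tinverse_def square_def)
  with B show "\<exists>Y. vinverse (fold A) Y"
    using tinverse_iff_fold square_self[OF assms] by blast
next
  assume "\<exists>Y. vinverse (fold A) Y"
  then obtain Y where Y: "vinverse (fold A) Y" ..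
  obtain n s w e where A: "square n s w e A"
    using square_self assms by blast
  note [simp] = squareD[OF A] fold_vinverseD[OF A Y]
  \<comment> \<open>The inverse \<open>Y\<close> runs from \<open>w \<cdot> s\<close> to
    \<open>n \<cdot> e\<close>, so it unfolds to a square with the reflected boundary.\<close>
  have "square w e n s (unfold w e n s Y)" and "fold (unfold w e n s Y) = Y"
    unfolding square_def by (intro conjI fold_unfold; simp)+
  then show "\<exists>B. tinverse A B"
    using tinverse_iff_fold[OF A] Y by metis
qed

end

section \<open>Adjacent directions of a cubical category\<close>

locale cubical_square = cubical_omega_category C for C :: "'a cubical" +
  fixes n i :: nat
  assumes i_pos: "1 \<le> i" and i_less: "i < n"

text \<open>Edges of both kinds are composed in direction \<open>i\<close>: removing direction
  \<open>i\<close> renumbers \<open>i + 1\<close> to \<open>i\<close>, and removing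
  \<open>i + 1\<close> leaves \<open>i\<close> unchanged.\<close>

sublocale cubical_square \<subseteq> double_category "cells C n" "cells C (n - 1)" "cells C (n - 2)"
  "face C (n - 1) i Neg" "face C (n - 1) i Pos" "degen C (n - 2) i" "cmp C (n - 1) i"
  "face C n i Neg" "face C n i Pos" "face C n (i + 1) Neg" "face C n (i + 1) Pos"
  "degen C (n - 1) i" "degen C (n - 1) (i + 1)" "conn C (n - 1) i Pos" "conn C (n - 1) i Neg"
  "cmp C n i" "cmp C n (i + 1)"
proof -
  obtain m where n: "n = Suc (Suc m)"
    using i_pos i_less by (cases n; cases "n - 1") auto
  have i: "1 \<le> i" "i \<le> Suc m"
    using i_pos i_less n by auto
  have face_face': "face C (Suc m) i \<alpha> (face C n i \<beta> A) = face C (Suc m) i \<beta> (face C n (Suc i) \<alpha> A)"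
    if "A \<in> cells C n" for A \<alpha> \<beta>
    using face_face[of A n i "Suc i" \<alpha> \<beta>] that i n by simp
  note axs = face_closed[of _ "Suc (Suc m)"] face_closed[of _ "Suc m"]
    degen_closed[of _ m] degen_closed[of _ "Suc m"] conn_closed[of _ "Suc m"] cmp_closed
    face_degen[of _ "Suc m"] face_degen_same[of _ m] face_degen_same[of _ "Suc m"]
    face_conn_same[of _ "Suc m"] face_conn_opp[of _ "Suc m" _ _ Neg] face_conn_opp[of _ "Suc m" _ _ Pos]
    face_cmp face_Neg_cmp face_Pos_cmp
    cmp_assoc[of _ i] cmp_assoc[of _ "Suc i"] interchange[of "Suc i" i] degen_cmp[of "Suc m"]
    conn_Neg_cmp[of "Suc m"] conn_Pos_cmp[of "Suc m"] conn_degen_same[of _ m] degen_degen[of _ m i i]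
    conn_cancel[of _ "Suc m"] conn_cancel_next[of _ "Suc m"]
    cmp_unit_left[of _ "Suc m"] cmp_unit_right[of _ "Suc m"]
    cmp_unit_left[of _ "Suc (Suc m)"] cmp_unit_right[of _ "Suc (Suc m)"]
  show "double_category (cells C n) (cells C (n - 1)) (cells C (n - 2))
    (face C (n - 1) i Neg) (face C (n - 1) i Pos) (degen C (n - 2) i) (cmp C (n - 1) i)
    (face C n i Neg) (face C n i Pos) (face C n (i + 1) Neg) (face C n (i + 1) Pos)
    (degen C (n - 1) i) (degen C (n - 1) (i + 1)) (conn C (n - 1) i Pos) (conn C (n - 1) i Neg)
    (cmp C n i) (cmp C n (i + 1))"
    by unfold_locales (use i in \<open>simp_all add: n composable_def up_def down_def
      face_face'[unfolded n] axs[simplified]\<close>)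
qed

section \<open>Invertibility of cells as invertibility of squares\<close>

context cubical_square
begin

declare One_nat_def [simp del]

lemma all_sign_iff: "(\<forall>\<alpha>. P \<alpha>) \<longleftrightarrow> P Neg \<and> P Pos"
  by (metis sign.exhaust)

lemma psi_eq_fold: "psi C n i = fold"
  by (simp add: fun_eq_iff psi_def fold_def)

lemma R_invertible_iff_vinverse: "A \<in> cells C n \<Longrightarrow> R_invertible C n i A \<longleftrightarrow> (\<exists>B. vinverse A B)"
  using i_pos i_less by (auto simp: R_invertible_def vinverse_def composable_def)

lemma R_invertible_iff_hinverse: "A \<in> cells C n \<Longrightarrow> R_invertible C n (i + 1) A \<longleftrightarrow> (\<exists>B. hinverse A B)"
  using i_pos i_less by (auto simp: R_invertible_def hinverse_def composable_def)

lemma R_invertible_iff_edge_inverse: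
  "x \<in> cells C (n - 1) \<Longrightarrow> R_invertible C (n - 1) i x \<longleftrightarrow> (\<exists>y. edge_inverse x y)"
  using i_pos i_less
  by (auto simp: R_invertible_def edge_inverse_def composable_def diff_diff_add)

lemma T_invertible_iff_tinverse: "A \<in> cells C n \<Longrightarrow> T_invertible C n i A \<longleftrightarrow> (\<exists>B. tinverse A B)"
  unfolding T_invertible_def is_T_inverse_def tinverse_def all_sign_iff Bex_def
  by (rule ex_cong1) blast

lemma psi_closed: "A \<in> cells C n \<Longrightarrow> psi C n i A \<in> cells C n"
  by (simp add: psi_eq_fold)

lemma T_invertible_iff_psi:
  "A \<in> cells C n \<Longrightarrow> T_invertible C n i A \<longleftrightarrow> R_invertible C n i (psi C n i A)"
  by (simp add: T_invertible_iff_tinverse R_invertible_iff_vinverse psi_eq_fold ex_tinverse_iff)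

lemma R_invertible_if_psi:
  assumes "A \<in> cells C n" "R_invertible C n i (psi C n i A)"
    and "\<And>\<alpha>. R_invertible C (n - 1) i (face C n (i + 1) \<alpha> A)"
  shows "R_invertible C n i A"
  using assms(2) assms(3)[of Neg] assms(3)[of Pos] vinverse_if_fold[OF square_self[OF assms(1)]] assms(1)
  by (auto simp: R_invertible_iff_vinverse R_invertible_iff_edge_inverse psi_eq_fold)

lemma R_invertible_next_if_psi:
  assumes "A \<in> cells C n" "R_invertible C n i (psi C n i A)"
    and "\<And>\<alpha>. R_invertible C (n - 1) i (face C n i \<alpha> A)"
  shows "R_invertible C n (i + 1) A"
  using assms(2) assms(3)[of Neg] assms(3)[of Pos] hinverse_if_fold[OF square_self[OF assms(1)]] assms(1)
  by (auto simp: R_invertible_iff_vinverse R_invertible_iff_hinverse R_invertible_iff_edge_inverse psi_eq_fold)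

lemma R_invertible_psi_if_next:
  assumes "A \<in> cells C n" "R_invertible C n (i + 1) A"
  shows "R_invertible C n i (psi C n i A)"
  using assms fold_vinverse_if_hinverse
  by (auto simp: R_invertible_iff_vinverse R_invertible_iff_hinverse psi_eq_fold)

end

section \<open>Closure properties of R-invertible cells\<close>

context cubical_omega_category
begin

declare One_nat_def [simp del]

lemma cubical_squareI: "1 \<le> i \<Longrightarrow> i < n \<Longrightarrow> cubical_square C n i"
  by unfold_locales

lemma R_invertible_degen_same:
  assumes "A \<in> cells C n" "i \<in> {1..n + 1}"
  shows "R_invertible C (n + 1) i (degen C n i A)"
proof -
  have "degen C n i A \<in> cells C (n + 1)"
    using assms by (rule degen_closed)
  moreover have "cmp C (n + 1) i (degen C n i A) (degen C n i A) = degen C n i A"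
    using cmp_unit_right[of "degen C n i A" "n + 1" i] calculation assms
    by (simp add: face_degen_same)
  ultimately show ?thesis
    using assms unfolding R_invertible_def
    by (intro bexI[of _ "degen C n i A"]) (simp_all add: composable_def face_degen_same)
qed

text \<open>Keeping the inverse visible allows its faces to be followed and its uniqueness to be
  used.\<close>

definition R_inverse :: "nat \<Rightarrow> nat \<Rightarrow> 'a \<Rightarrow> 'a \<Rightarrow> bool" where
  "R_inverse n k A B \<longleftrightarrow> composable C n k A B \<and> composable C n k B A \<and>
     cmp C n k A B = degen C (n - 1) k (face C n k Neg A) \<and>
     cmp C n k B A = degen C (n - 1) k (face C n k Pos A)"

lemma R_invertible_iff: "R_invertible C n k A \<longleftrightarrow> (\<exists>B. R_inverse n k A B)"
  by (auto simp: R_invertible_def R_inverse_def composable_def)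

lemma R_inverse_unique:
  assumes B: "R_inverse n k A B" and D: "R_inverse n k A D"
  shows "B = D"
proof -
  have AB: "composable C n k A B" "composable C n k B A" and AD: "composable C n k A D"
    using B D by (auto simp: R_inverse_def)
  have "B = cmp C n k B (degen C (n - 1) k (face C n k Neg A))"
    using AB cmp_unit_right[of B n k] by (simp add: composable_def)
  also have "\<dots> = cmp C n k B (cmp C n k A D)"
    using D by (simp add: R_inverse_def)
  also have "\<dots> = cmp C n k (cmp C n k B A) D"
    using AB AD by (simp add: cmp_assoc)
  also have "\<dots> = cmp C n k (degen C (n - 1) k (face C n k Neg D)) D"
    using B AD by (simp add: R_inverse_def composable_def)
  also have "\<dots> = D"
    using AD by (simp add: composable_def cmp_unit_left)
  finally show ?thesis .
qed

text \<open>Unites the cases \<open>j < k\<close> and \<open>k < j\<close> of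
  \<open>face_face\<close>.\<close>

lemma face_face_down:
  assumes "A \<in> cells C n" "j \<in> {1..n}" "k \<in> {1..n}" "j \<noteq> k"
  shows "face C (n - 1) (down k j) \<alpha> (face C n j \<beta> A) = face C (n - 1) (down j k) \<beta> (face C n k \<alpha> A)"
  using assms face_face[of A n j k \<alpha> \<beta>] face_face[of A n k j \<beta> \<alpha>]
  by (cases "j < k") (auto simp: down_def)

lemma composable_face:
  assumes AB: "composable C n k A B" and j: "j \<in> {1..n}" "j \<noteq> k"
  shows "composable C (n - 1) (down k j) (face C n j \<alpha> A) (face C n j \<alpha> B)"
  using assms face_face_down[of A n j k] face_face_down[of B n j k]
  by (auto simp: composable_def face_closed) (auto simp: down_def)

text \<open>For \<open>j \<noteq> k\<close>, faces in direction \<open>j\<close> preserve composites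
  and units in direction \<open>k\<close>, up to renumbering.\<close>

lemma R_inverse_face:
  assumes AB: "R_inverse n k A B" and j: "j \<in> {1..n}" "j \<noteq> k"
  shows "R_inverse (n - 1) (down k j) (face C n j \<alpha> A) (face C n j \<alpha> B)"
proof -
  obtain p where n: "n = p + 1"
    using j by (cases n) auto
  have c: "composable C n k A B" "composable C n k B A"
    using AB by (auto simp: R_inverse_def)
  then have A: "A \<in> cells C n" "k \<in> {1..n}"
    by (auto simp: composable_def)
  have "face C n j \<alpha> (degen C p k (face C n k \<beta> A))
      = degen C (p - 1) (down k j) (face C p (down k j) \<beta> (face C n j \<alpha> A))" for \<beta>
    using A j face_closed[OF A] face_face_down[OF A(1) j(1) A(2) j(2)] n
    by (simp add: face_degen)
  then show ?thesis
    using AB composable_face[OF c(1) j] composable_face[OF c(2) j]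
      face_cmp[OF c(1) j, symmetric] face_cmp[OF c(2) j, symmetric] n
    by (simp add: R_inverse_def)
qed

text \<open>Uniqueness of inverses makes the inverses of \<open>A\<close> and \<open>B\<close> composable in direction \<open>j\<close>.\<close>

lemma R_invertible_cmp:
  assumes AB: "composable C n j A B" and kj: "k \<noteq> j"
    and "R_invertible C n k A" "R_invertible C n k B"
  shows "R_invertible C n k (cmp C n j A B)"
proof -
  obtain A' B' where A': "R_inverse n k A A'" and B': "R_inverse n k B B'"
    using assms by (auto simp: R_invertible_iff)
  have A: "composable C n k A A'" "composable C n k A' A"
    "cmp C n k A A' = degen C (n - 1) k (face C n k Neg A)"
    "cmp C n k A' A = degen C (n - 1) k (face C n k Pos A)"
    using A' by (auto simp: R_inverse_def)
  have B: "composable C n k B B'" "composable C n k B' B"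
    "cmp C n k B B' = degen C (n - 1) k (face C n k Neg B)"
    "cmp C n k B' B = degen C (n - 1) k (face C n k Pos B)"
    using B' by (auto simp: R_inverse_def)
  have j: "j \<in> {1..n}" and k: "k \<in> {1..n}"
    using AB A by (auto simp: composable_def)
  obtain p where n: "n = p + 1"
    using j by (cases n) auto
  have "face C n j Pos A' = face C n j Neg B'"
    using R_inverse_face[OF A' j kj[symmetric], of Pos] R_inverse_face[OF B' j kj[symmetric], of Neg] AB
    by (auto simp: composable_def intro: R_inverse_unique)
  then have AB': "composable C n j A' B'"
    using A B j by (auto simp: composable_def)
  have up: "up (down j k) k = j"
    using kj j k by (auto simp: up_def down_def)
  have units: "degen C (n - 1) k (face C n k \<alpha> (cmp C n j X Y)) =
      cmp C n j (degen C (n - 1) k (face C n k \<alpha> X)) (degen C (n - 1) k (face C n k \<alpha> Y))"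
    if "composable C n j X Y" for X Y \<alpha>
    using face_cmp[OF that k kj] degen_cmp[OF composable_face[OF that k kj], of k] k n up by simp
  have f: "face C n k Pos (cmp C n j A B) = face C n k Neg (cmp C n j A' B')"
    "face C n k Pos (cmp C n j A' B') = face C n k Neg (cmp C n j A B)"
    using A B face_cmp[OF AB k kj] face_cmp[OF AB' k kj] by (auto simp: composable_def)
  have "R_inverse n k (cmp C n j A B) (cmp C n j A' B')"
    unfolding R_inverse_def
    using interchange[OF kj[symmetric] AB AB' A(1) B(1)] interchange[OF kj[symmetric] AB' AB A(2) B(2)]
      A B cmp_closed[OF AB] cmp_closed[OF AB'] k f units[OF AB] units[OF AB']
    by (simp add: composable_def)
  then show ?thesis
    by (auto simp: R_invertible_iff)
qed

text \<open>For \<open>k < j\<close> the degeneracy keeps the direction \<open>k\<close> of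
  composites and sends units to units, so it carries the inverse along.\<close>

lemma R_invertible_degen:
  assumes "A \<in> cells C n" "1 \<le> k" "k < j" "j \<le> n + 1" "R_invertible C n k A"
  shows "R_invertible C (n + 1) k (degen C n j A)"
proof -
  obtain B where B: "composable C n k A B" "composable C n k B A"
    "cmp C n k A B = degen C (n - 1) k (face C n k Neg A)"
    "cmp C n k B A = degen C (n - 1) k (face C n k Pos A)"
    using assms(5) by (auto simp: R_invertible_iff R_inverse_def)
  have j: "j \<in> {1..n + 1}" and k: "k \<in> {1..n}" "k \<in> {1..n + 1}" "k \<noteq> j" "up k j = k" "down k j = k" "down j k = j - 1"
    using assms B by (auto simp: composable_def up_def down_def)
  obtain p where n: "n = p + 1"
    using k by (cases n) auto
  have f: "face C (n + 1) k \<alpha> (degen C n j X) = degen C (n - 1) (j - 1) (face C n k \<alpha> X)"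
    if "X \<in> cells C n" for X \<alpha>
    using face_degen[OF that k(2) j k(3)] k by simp
  have d: "degen C n j (degen C (n - 1) k x) = degen C n k (degen C (n - 1) (j - 1) x)" if "x \<in> cells C (n - 1)" for x
    using degen_degen[of x "n - 1" k "j - 1"] that assms n by simp
  have "R_inverse (n + 1) k (degen C n j A) (degen C n j B)"
    using degen_cmp[OF B(1) j] degen_cmp[OF B(2) j] k B j
    by (auto simp: R_inverse_def composable_def f d degen_closed face_closed)
  then show ?thesis
    by (auto simp: R_invertible_iff)
qed

lemma R_invertible_conn:
  assumes "A \<in> cells C n" "1 \<le> k" "k < j" "j \<le> n" "R_invertible C n k A"
  shows "R_invertible C (n + 1) k (conn C n j \<alpha> A)"
proof -
  obtain B where B: "composable C n k A B" "composable C n k B A"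
    "cmp C n k A B = degen C (n - 1) k (face C n k Neg A)"
    "cmp C n k B A = degen C (n - 1) k (face C n k Pos A)"
    using assms(5) by (auto simp: R_invertible_iff R_inverse_def)
  have j: "j \<in> {1..n}" "j \<noteq> k"
    and k: "k \<in> {1..n}" "k \<in> {1..n + 1}" "k \<noteq> j" "k \<noteq> j + 1" "up k j = k" "down k j = k" "down j k = j - 1"
    using assms B by (auto simp: composable_def up_def down_def)
  obtain p where n: "n = p + 1"
    using k by (cases n) auto
  have f: "face C (n + 1) k \<beta> (conn C n j \<alpha> X) = conn C (n - 1) (j - 1) \<alpha> (face C n k \<beta> X)"
    if "X \<in> cells C n" for X \<beta>
    using face_conn[OF that k(2) j(1) k(3,4)] k by simp
  have d: "conn C n j \<alpha> (degen C (n - 1) k x) = degen C n k (conn C (n - 1) (j - 1) \<alpha> x)" if "x \<in> cells C (n - 1)" for x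
    using conn_degen[of x "n - 1" j k \<alpha>] that j k n by simp
  have "R_inverse (n + 1) k (conn C n j \<alpha> A) (conn C n j \<alpha> B)"
    using conn_cmp[OF B(1) j, of \<alpha>, symmetric] conn_cmp[OF B(2) j, of \<alpha>, symmetric] k B j
    by (simp add: R_inverse_def composable_def f d conn_closed face_closed)
  then show ?thesis
    by (auto simp: R_invertible_iff)
qed

text \<open>Faces away from the two folded directions commute with folding. In the inductions on
  dimension this makes faces of folded cells accessible as folded faces.\<close>

lemma face_psi:
  assumes "A \<in> cells C n" "1 \<le> i" "i < n" "j \<in> {1..n}" "j \<noteq> i" "j \<noteq> i + 1"
  shows "face C n j \<alpha> (psi C n i A) = psi C (n - 1) (down i j) (face C n j \<alpha> A)"
proof -
  obtain p where n: "n = p + 1"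
    using assms by (cases n) auto
  have ij: "i + 1 \<in> {1..n}" "i \<in> {1..p}" "down (i + 1) j = down i j + 1" "down j (i + 1) = down j i"
    using assms n by (auto simp: down_def)
  note A = \<open>A \<in> cells C n\<close>
  interpret cubical_square C n i
    using assms by unfold_locales auto
  have g: "composable C n (i + 1) (conn C (n - 1) i Pos (face C n (i + 1) Neg A)) A"
    "composable C n (i + 1) (cmp C n (i + 1) (conn C (n - 1) i Pos (face C n (i + 1) Neg A)) A)
      (conn C (n - 1) i Neg (face C n (i + 1) Pos A))"
    unfolding composable_def using A ij by simp_all
  have "face C n j \<alpha> (conn C p i \<beta> (face C n (i + 1) \<gamma> A))
      = conn C (p - 1) (down i j) \<beta> (face C p (down i j + 1) \<gamma> (face C n j \<alpha> A))" for \<beta> \<gamma>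
    using assms face_closed[OF A ij(1), of \<gamma>] face_face_down[OF A assms(4) ij(1) assms(6), of \<gamma> \<alpha>] ij n
    by (simp add: face_conn)
  then show ?thesis
    using face_cmp[OF g(1) assms(4,6)] face_cmp[OF g(2) assms(4,6)] n ij
    by (simp add: psi_def)
qed

end

section \<open>Faces of folded cells, and unfolding in lower directions\<close>

context cubical_square
begin

declare One_nat_def [simp del]

text \<open>These faces are the composite edges \<open>N \<cdot> E\<close> and
  \<open>W \<cdot> S\<close>, so \<open>R_invertible_cmp\<close> applies.\<close>

lemma R_invertible_face_psi:
  assumes A: "A \<in> cells C n" and k: "k \<noteq> i"
    and f: "\<And>\<alpha>. R_invertible C (n - 1) k (face C n i \<alpha> A)"
    "\<And>\<alpha>. R_invertible C (n - 1) k (face C n (i + 1) \<alpha> A)"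
  shows "R_invertible C (n - 1) k (face C n i \<alpha> (psi C n i A))"
proof -
  have "composable C (n - 1) i (face C n i Neg A) (face C n (i + 1) Pos A)"
    "composable C (n - 1) i (face C n (i + 1) Neg A) (face C n i Pos A)"
    using A corners[OF A] i_pos i_less by (auto simp: composable_def)
  then have "R_invertible C (n - 1) k (cmp C (n - 1) i (face C n i Neg A) (face C n (i + 1) Pos A))"
    "R_invertible C (n - 1) k (cmp C (n - 1) i (face C n (i + 1) Neg A) (face C n i Pos A))"
    using k f by (auto intro: R_invertible_cmp)
  then show ?thesis
    using A by (cases \<alpha>) (simp_all add: psi_eq_fold)
qed

text \<open>These faces are identity edges, hence their own inverses.\<close>

lemma R_invertible_face_next_psi:
  assumes A: "A \<in> cells C n"
  shows "R_invertible C (n - 1) i (face C n (i + 1) \<alpha> (psi C n i A))"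
proof -
  have "R_invertible C (n - 1) i (degen C (n - 2) i a)" if "a \<in> cells C (n - 2)" for a
  proof -
    have "n - 2 + 1 = n - 1"
      using i_pos i_less by simp
    then show ?thesis
      using R_invertible_degen_same[OF that, of i] i_pos i_less by simp
  qed
  then show ?thesis
    using A by (cases \<alpha>) (simp_all add: psi_eq_fold)
qed

text \<open>Unfolding writes \<open>A\<close> as a composite of \<open>psi C n i A\<close> with the
  rows \<open>?P\<close> and \<open>?Q\<close>, built from degeneracies and connections on faces of
  \<open>A\<close>. For \<open>k < i\<close> all these pieces are \<open>R_k\<close>-invertible and
  are composed in directions other than \<open>k\<close>.\<close>

lemma R_invertible_lower_if_psi:
  assumes A: "A \<in> cells C n" and k: "1 \<le> k" "k < i" and R: "R_invertible C n k (psi C n i A)"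
    and f: "\<And>\<alpha>. R_invertible C (n - 1) k (face C n i \<alpha> A)"
    "\<And>\<alpha>. R_invertible C (n - 1) k (face C n (i + 1) \<alpha> A)"
  shows "R_invertible C n k A"
proof -
  let ?a = "\<lambda>\<alpha>. face C n i \<alpha> A" and ?b = "\<lambda>\<alpha>. face C n (i + 1) \<alpha> A"
  let ?P = "cmp C n (i + 1) (degen C (n - 1) i (?a Neg)) (conn C (n - 1) i Pos (?b Pos))"
  let ?Q = "cmp C n (i + 1) (conn C (n - 1) i Neg (?b Neg)) (degen C (n - 1) i (?a Pos))"
  have n: "n - 1 + 1 = n"
    using i_less by simp
  have e: "R_invertible C n k (degen C (n - 1) i (?a \<alpha>))" for \<alpha>
    using R_invertible_degen[of "?a \<alpha>" "n - 1" k i] f k i_less n A face_closed[OF A] by simp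
  have g: "R_invertible C n k (conn C (n - 1) i \<beta> (?b \<alpha>))" for \<alpha> \<beta>
    using R_invertible_conn[of "?b \<alpha>" "n - 1" k i] f k i_less n A face_closed[OF A] by simp
  have "R_invertible C n k ?P" "R_invertible C n k ?Q"
    using k A i_pos i_less by (intro R_invertible_cmp e g; simp add: composable_def)+
  moreover have "composable C n i ?P (psi C n i A)" "composable C n i (cmp C n i ?P (psi C n i A)) ?Q"
    using A i_pos i_less by (simp_all add: composable_def psi_eq_fold)
  ultimately have "R_invertible C n k (cmp C n i (cmp C n i ?P (psi C n i A)) ?Q)"
    using R k by (auto intro: R_invertible_cmp)
  then show ?thesis
    using unfold_fold[OF A] by (simp add: unfold_def psi_eq_fold)
qed

end

section \<open>Iterated folding and the two inductions on dimension\<close>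

context cubical_omega_category
begin

declare One_nat_def [simp del]

text \<open>The cell \<open>A_k\<close> of the overview; the list is empty for \<open>k = n\<close>,
  so \<open>A_n\<close> is \<open>A\<close>.\<close>

definition psis :: "nat \<Rightarrow> nat \<Rightarrow> 'a \<Rightarrow> 'a" where
  "psis n k A = foldr (psi C n) [k..<n] A"

lemma psis_step: "k < n \<Longrightarrow> psis n k A = psi C n k (psis n (k + 1) A)"
  by (simp add: psis_def upt_rec[of k n] Suc_eq_plus1)

lemma psis_last: "n \<le> k \<Longrightarrow> psis n k A = A"
  by (simp add: psis_def)

lemma psis_closed:
  assumes "A \<in> cells C n" "1 \<le> k"
  shows "psis n k A \<in> cells C n"
proof (cases "k \<le> n")
  case True
  then show ?thesis
    using assms(2)
  proof (induction rule: inc_induct)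
    case base
    then show ?case using assms by (simp add: psis_last)
  next
    case (step m)
    then show ?case
      using cubical_square.psi_closed[OF cubical_squareI, of m n] by (simp add: psis_step Suc_eq_plus1)
  qed
qed (use assms in \<open>simp add: psis_last\<close>)

lemma invertible_iff_psis: "invertible C n A \<longleftrightarrow> R_invertible C n 1 (psis n 1 A)"
  by (simp add: invertible_def psis_def)

text \<open>The climb: since \<open>A_k\<close> is the folding of \<open>A_{k+1}\<close> in
  direction \<open>k\<close>, invertible north and south edges of \<open>A_{k+1}\<close> raise the
  direction by one. The bound \<open>m\<close> allows the climb to stop early.\<close>

lemma R_invertible_psis:
  assumes A: "A \<in> cells C n" and "invertible C n A" and m: "1 \<le> m" "m \<le> n"
    and f: "\<And>k \<alpha>. \<lbrakk>1 \<le> k; k < m\<rbrakk> \<Longrightarrow> R_invertible C (n - 1) k (face C n k \<alpha> (psis n (k + 1) A))"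
  shows "R_invertible C n m (psis n m A)"
proof -
  have "k \<le> m \<longrightarrow> R_invertible C n k (psis n k A)" if "1 \<le> k" for k
    using that
  proof (induction rule: dec_induct)
    case base
    then show ?case using assms by (simp add: invertible_iff_psis)
  next
    case (step k)
    show ?case
    proof
      assume "Suc k \<le> m"
      then interpret cubical_square C n k
        using step m by unfold_locales auto
      have "R_invertible C n (k + 1) (psis n (k + 1) A)"
        using step f i_less \<open>Suc k \<le> m\<close>
        by (intro R_invertible_next_if_psi psis_closed A) (simp_all add: psis_step)
      then show "R_invertible C n (Suc k) (psis n (Suc k) A)"
        by (simp add: Suc_eq_plus1)
    qed
  qed
  then show ?thesis using m by simp
qed

lemma R_invertible_if_groupoid:
  assumes inv: "\<And>n A. \<lbrakk>1 \<le> n; A \<in> cells C n\<rbrakk> \<Longrightarrow> invertible C n A"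
  shows "\<lbrakk>A \<in> cells C n; i \<in> {1..n}\<rbrakk> \<Longrightarrow> R_invertible C n i A"
proof (induction n arbitrary: A i)
  case 0
  then show ?case by simp
next
  case (Suc p)
  define n where "n = Suc p"
  have A: "A \<in> cells C n" and i: "1 \<le> i" "i \<le> n"
    using Suc.prems by (auto simp: n_def)
  have IH: "R_invertible C (n - 1) k (face C n j \<alpha> B)"
    if "B \<in> cells C n" "1 \<le> j" "j \<le> n" "1 \<le> k" "k < n" for B j k \<alpha>
    using Suc.IH[of "face C n j \<alpha> B" k] that face_closed[of B n j] by (simp add: n_def)
  have top: "R_invertible C n n A"
    using R_invertible_psis[OF A inv[OF _ A], of n] IH psis_closed[OF A] i by (simp add: psis_last)
  \<comment> \<open>The descent: \<open>R_{m+1}\<close>-invertibility of \<open>A\<close> gives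
    \<open>R_m\<close>-invertibility of \<open>psi C n m A\<close>, and then of \<open>A\<close>,
    whose faces are invertible by induction.\<close>
  from i(2) have "R_invertible C n i A"
  proof (induction rule: inc_induct)
    case base
    show ?case by (rule top)
  next
    case (step m)
    then interpret cubical_square C n m
      using i by unfold_locales auto
    show ?case
      using R_invertible_psi_if_next[OF A] R_invertible_if_psi[OF A] IH[OF A] i step by (simp add: Suc_eq_plus1)
  qed
  then show ?case by (simp add: n_def)
qed

lemma T_invertible_if_omega_1:
  assumes inv: "\<And>n A. \<lbrakk>2 \<le> n; A \<in> cells C n\<rbrakk> \<Longrightarrow> invertible C n A"
  shows "\<lbrakk>A \<in> cells C n; 1 \<le> i; i < n\<rbrakk> \<Longrightarrow> T_invertible C n i A"
proof (induction n arbitrary: A i)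
  case 0
  then show ?case by simp
next
  case (Suc p)
  define n where "n = Suc p"
  have i: "1 \<le> i" "i < n"
    using Suc.prems by (auto simp: n_def)
  have sq: "cubical_square C n k" if "1 \<le> k" "k < n" for k
    using that by (rule cubical_squareI)
  have IH: "R_invertible C (n - 1) k (psi C (n - 1) k (face C n j \<alpha> B))"
    if "B \<in> cells C n" "1 \<le> j" "j \<le> n" "1 \<le> k" "k < n - 1" for B j k \<alpha>
    using Suc.IH[of "face C n j \<alpha> B" k] that face_closed[of B n j]
      cubical_square.T_invertible_iff_psi[OF cubical_squareI[of k p]]
    by (simp add: n_def)
  \<comment> \<open>This face equals \<open>psi C (n - 1) k (face C n k \<alpha> B)\<close>, to
    which \<open>IH\<close> applies. The cell must be folded in direction \<open>k + 1\<close>, so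
    the climb reaches only \<open>n - 1\<close>.\<close>
  have face_low: "R_invertible C (n - 1) k (face C n k \<alpha> (psi C n (k + 1) B))"
    if "B \<in> cells C n" "1 \<le> k" "k + 1 < n" for B k \<alpha>
    using face_psi[of B n "k + 1" k] IH[of B k k] that by (simp add: down_def)
  have last: "T_invertible C n (n - 1) A" if A: "A \<in> cells C n" for A
  proof -
    have "R_invertible C n (n - 1) (psis n (n - 1) A)"
      using i by (intro R_invertible_psis A inv) (auto simp: psis_step intro!: face_low psis_closed A)
    then show ?thesis
      using cubical_square.T_invertible_iff_psi[OF sq A, of "n - 1"] i by (simp add: psis_step psis_last)
  qed
  from i(2) have "i \<le> n - 1" by simp
  \<comment> \<open>Quantified over all cells because the descent applies it to
    \<open>psi C n m A\<close>.\<close>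
  then have "\<forall>A \<in> cells C n. T_invertible C n i A"
  proof (induction rule: inc_induct)
    case base
    show ?case using last by simp
  next
    case (step m)
    have m: "1 \<le> m" "m + 1 < n"
      using i step by auto
    interpret low: cubical_square C n m
      using m by unfold_locales auto
    interpret high: cubical_square C n "m + 1"
      using m by unfold_locales auto
    show ?case
    proof
      fix A assume A: "A \<in> cells C n"
      \<comment> \<open>The chain is: \<open>B\<close> is \<open>T_{m+1}\<close>-invertible, so
        \<open>X\<close> is \<open>R_{m+1}\<close>-invertible, hence \<open>psi C n m X\<close> and
        then \<open>X\<close> are \<open>R_m\<close>-invertible; unfolding in directions
        \<open>m + 1\<close>, \<open>m + 2\<close> passes this to \<open>B\<close>, which is
        \<open>T_m\<close>-invertibility of \<open>A\<close>.\<close>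
      define B where "B = psi C n m A"
      define X where "X = psi C n (m + 1) B"
      have B: "B \<in> cells C n" and X: "X \<in> cells C n"
        by (simp_all add: A B_def X_def low.psi_closed high.psi_closed)
      have f1: "R_invertible C (n - 1) m (face C n (m + 1) \<alpha> B)" for \<alpha>
        unfolding B_def using A by (rule low.R_invertible_face_next_psi)
      \<comment> \<open>Direction \<open>m + 2\<close> lies outside the folded pair, so this face is
        a folded face of \<open>A\<close>.\<close>
      have f2: "R_invertible C (n - 1) m (face C n (m + 1 + 1) \<alpha> B)" for \<alpha>
        using face_psi[OF A, of m "m + 1 + 1"] IH[OF A] m by (simp add: B_def down_def)
      have "R_invertible C n (m + 1) X"
        using step.IH B high.T_invertible_iff_psi[OF B] by (simp add: X_def Suc_eq_plus1)
      then have "R_invertible C n m (psi C n m X)"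
        by (rule low.R_invertible_psi_if_next[OF X])
      moreover have "R_invertible C (n - 1) m (face C n (m + 1) \<alpha> X)" for \<alpha>
        unfolding X_def using f1 f2 by (intro high.R_invertible_face_psi B) simp_all
      ultimately have "R_invertible C n m X"
        by (rule low.R_invertible_if_psi[OF X])
      then have "R_invertible C n m B"
        unfolding X_def using f1 f2 m by (intro high.R_invertible_lower_if_psi[OF B]) simp_all
      then show "T_invertible C n m A"
        by (simp add: B_def low.T_invertible_iff_psi[OF A])
    qed
  qed
  then show ?case using Suc.prems by (simp add: n_def)
qed

end

theorem corollary4p1p4:
  fixes C :: "'a cubical"
  assumes "cubical_omega_category C"
  shows "(cubical_omega_groupoid C \<longleftrightarrow>
            (\<forall>n \<ge> 1. \<forall>A \<in> cells C n. \<forall>i \<in> {1..n}. R_invertible C n i A))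
       \<and> (cubical_omega_p_category 1 C \<longleftrightarrow>
            (\<forall>n \<ge> 2. \<forall>A \<in> cells C n. \<forall>i \<in> {1..<n}. T_invertible C n i A))"
proof -
  interpret cubical_omega_category C by fact
  have "R_invertible C n i A"
    if "cubical_omega_groupoid C" "n \<ge> 1" "A \<in> cells C n" "i \<in> {1..n}" for n A i
    using that R_invertible_if_groupoid
    by (auto simp: cubical_omega_groupoid_def cubical_omega_p_category_def Suc_le_eq)
  moreover have "cubical_omega_groupoid C"
    if "\<forall>n \<ge> 1. \<forall>A \<in> cells C n. \<forall>i \<in> {1..n}. R_invertible C n i A"
    using that assms psis_closed
    by (auto simp: cubical_omega_groupoid_def cubical_omega_p_category_def invertible_iff_psis Suc_le_eq)
  moreover have "T_invertible C n i A"
    if "cubical_omega_p_category 1 C" "n \<ge> 2" "A \<in> cells C n" "i \<in> {1..<n}" for n A i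
    using that T_invertible_if_omega_1 by (auto simp: cubical_omega_p_category_def)
  moreover have "cubical_omega_p_category 1 C"
    if T: "\<forall>n \<ge> 2. \<forall>A \<in> cells C n. \<forall>i \<in> {1..<n}. T_invertible C n i A"
    unfolding cubical_omega_p_category_def
  proof (intro conjI allI impI ballI assms)
    fix n A assume n: "1 < (n::nat)" and A: "A \<in> cells C n"
    interpret cubical_square C n 1
      using n by unfold_locales auto
    \<comment> \<open>\<open>T_1\<close>-invertibility of \<open>A_2\<close> is
      \<open>R_1\<close>-invertibility of its folding \<open>A_1\<close>, that is, invertibility of
      \<open>A\<close>.\<close>
    have "psis n 2 A \<in> cells C n"
      using A by (rule psis_closed) simp
    then show "invertible C n A"
      using T n T_invertible_iff_psi[of "psis n 2 A"] psis_step[of 1 n A]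
      by (simp add: invertible_iff_psis numeral_2_eq_2)
  qed
  ultimately show ?thesis by blast
qed

end
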